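(* Let $T$ be a tree with at least two vertices. Then the set of leaves (vertices of degree $1$) of $T$ is a fault tolerant zero forcing set of $T$. Hence $\mathrm{Z}_t(T)\le \ell(T)$, where $\ell(T)$ is the number of leaves of $T$.
   Context: Zero forcing: given a set $B\subseteq V(G)$ of initially blue vertices (all others white), the color change rule allows a blue vertex $b$ to turn a white vertex $w$ blue if $w$ is the unique white neighbor of $b$. $B$ is a zero forcing set if repeated application of this rule eventually turns all of $V(G)$ blue. A set $B\subseteq V(G)$ with $|B|=m\ge 1$ is a fault tolerant zero forcing set if every subset $F\subseteq B$ with $|F|=m-1$ is a zero forcing set of $G$. $\mathrm{Z}_t(G)$ is the minimum cardinality of a fault tolerant zero forcing set of $G$. *)

theory Defs
  imports "Graph_Theory.Digraph_Component"
begin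

text \<open>
  Following the library convention, a finite simple undirected graph is a finite symmetric digraph
  without loops and parallel arcs (locale \<open>graph\<close>): every undirected edge is a pair of opposite arcs.
\<close>

definition neighbors :: "('a, 'b) pre_digraph \<Rightarrow> 'a \<Rightarrow> 'a set" where
  "neighbors G v = {u \<in> verts G. v \<rightarrow>\<^bsub>G\<^esub> u}"

text \<open>
  The library predicate \<open>tree\<close> is not usable for symmetric digraphs, since there the two opposite
  arcs of a single edge already form a directed cycle (of length 2). The cycles of a simple
  undirected graph are the directed cycles of length at least 3.
\<close>

definition undirected_tree :: "('a, 'b) pre_digraph \<Rightarrow> bool" where
  "undirected_tree G \<longleftrightarrow> graph G \<and> connected G \<and> \<not> (\<exists>p. pre_digraph.cycle G p \<and> 3 \<le> length p)"

definition leaves :: "('a, 'b) pre_digraph \<Rightarrow> 'a set" where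
  "leaves G = {v \<in> verts G. card (neighbors G v) = 1}"

definition color_change :: "('a, 'b) pre_digraph \<Rightarrow> 'a set \<Rightarrow> 'a set \<Rightarrow> bool" where
  "color_change G S S' \<longleftrightarrow> (\<exists>b\<in>S. \<exists>w. neighbors G b - S = {w} \<and> S' = insert w S)"

definition zero_forcing_set :: "('a, 'b) pre_digraph \<Rightarrow> 'a set \<Rightarrow> bool" where
  "zero_forcing_set G B \<longleftrightarrow> B \<subseteq> verts G \<and> (color_change G)\<^sup>*\<^sup>* B (verts G)"

definition fault_tolerant_zero_forcing_set :: "('a, 'b) pre_digraph \<Rightarrow> 'a set \<Rightarrow> bool" where
  "fault_tolerant_zero_forcing_set G B \<longleftrightarrow>
     B \<subseteq> verts G \<and> card B \<ge> 1 \<and> (\<forall>F. F \<subseteq> B \<and> card F = card B - 1 \<longrightarrow> zero_forcing_set G F)"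

text \<open>Unspecified if \<open>G\<close> has no fault tolerant zero forcing set.\<close>

definition fault_tolerant_zero_forcing_number :: "('a, 'b) pre_digraph \<Rightarrow> nat" where
  "fault_tolerant_zero_forcing_number G =
     (LEAST m. \<exists>B. fault_tolerant_zero_forcing_set G B \<and> card B = m)"

end

theory Submission
  imports Defs
begin

text \<open>
  Let \<open>S\<close> be a set that is closed under the color change rule and contains all leaves except
  possibly \<open>s\<close>, and suppose that \<open>s \<notin> S\<close>. Consider a path from \<open>s\<close> to a white vertex \<open>x\<close>. Since \<open>x\<close>
  is \<open>s\<close> or not a leaf, some neighbor \<open>u\<close> of \<open>x\<close> lies off the path. If \<open>u\<close> is white, it extends the
  path; if \<open>u\<close> is blue, then \<open>x\<close> is not its only white neighbor, and going through \<open>u\<close> to another one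
  extends the path by two. In a tree such an extension never meets the path again, so there would be
  arbitrarily long paths. Hence the closure of all leaves but one is the whole vertex set.
\<close>

text \<open>A vertex list grows at its head by plain consing; arcs matter only once a cycle has to
  be exhibited.\<close>

definition simple_path :: "('a, 'b) pre_digraph \<Rightarrow> 'a list \<Rightarrow> bool" where
  "simple_path G p \<longleftrightarrow> set p \<subseteq> verts G \<and> distinct p \<and> successively (\<lambda>x y. x \<rightarrow>\<^bsub>G\<^esub> y) p"

lemma (in wf_digraph) successively_imp_awalk:
  assumes "successively (\<lambda>x y. x \<rightarrow>\<^bsub>G\<^esub> y) (u # p)" "u \<in> verts G"
  shows "\<exists>q. awalk u q (last (u # p)) \<and> awalk_verts u q = u # p"
  using assms
proof (induction p arbitrary: u)
  case Nil
  then show ?case by (intro exI[of _ "[]"]) (simp add: awalk_Nil_iff)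
next
  case (Cons v p)
  then have "u \<rightarrow>\<^bsub>G\<^esub> v" by simp
  then obtain e where e: "e \<in> arcs G" "tail G e = u" "head G e = v"
    by (auto simp: arcs_ends_conv)
  with Cons obtain q where "awalk v q (last (v # p))" "awalk_verts v q = v # p"
    by fastforce
  with e show ?case by (intro exI[of _ "e # q"]) (auto simp: awalk_Cons_iff)
qed

lemma undirected_tree_adj_sym:
  assumes "undirected_tree G" "u \<rightarrow>\<^bsub>G\<^esub> v"
  shows "v \<rightarrow>\<^bsub>G\<^esub> u"
proof -
  interpret graph G using assms by (simp add: undirected_tree_def)
  show ?thesis using assms(2) sym_arcs by (auto simp: symmetric_def dest: symD)
qed

text \<open>If \<open>u\<close> lay on \<open>q\<close>, the stretch of the path from
  \<open>x\<close> to \<open>u\<close>, closed by the arc from \<open>u\<close> to \<open>x\<close>,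
  would be a cycle. Excluding \<open>u = hd q\<close> rules out merely stepping back along an
  edge.\<close>

lemma simple_path_extend:
  assumes tree: "undirected_tree G"
    and path: "simple_path G (x # q)"
    and adj: "u \<rightarrow>\<^bsub>G\<^esub> x"
    and fwd: "q \<noteq> [] \<Longrightarrow> u \<noteq> hd q"
  shows "simple_path G (u # x # q)"
proof -
  interpret graph G using tree by (simp add: undirected_tree_def)
  have uV: "u \<in> verts G" using adj adj_in_verts by blast
  have "u \<noteq> x" using adj adj_not_same by blast
  have "u \<notin> set q"
  proof
    assume "u \<in> set q"
    then obtain q1 q2 where q: "q = q1 @ u # q2" by (meson split_list)
    with fwd have "q1 \<noteq> []" by auto
    have "successively (\<lambda>x y. x \<rightarrow>\<^bsub>G\<^esub> y) (u # x # q1 @ [u])"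
      using path adj \<open>q1 \<noteq> []\<close> unfolding simple_path_def q
      by (auto simp: successively_append_iff successively_Cons)
    then obtain c where c: "awalk u c u" "awalk_verts u c = u # x # q1 @ [u]"
      using successively_imp_awalk[OF _ uV] by fastforce
    have "length (awalk_verts u c) = Suc (length c)" by (rule length_awalk_verts)
    \<comment> \<open>At least one vertex lies between \<open>x\<close> and the second
      \<open>u\<close>, so this is not the 2-cycle formed by the opposite arcs of an edge.\<close>
    with c \<open>q1 \<noteq> []\<close> have "3 \<le> length c" by (cases q1) auto
    moreover have "distinct (tl (awalk_verts u c))"
      using path \<open>u \<noteq> x\<close> unfolding c simple_path_def q by auto
    ultimately have "cycle c" using c unfolding cycle_def by auto
    with \<open>3 \<le> length c\<close> tree show False unfolding undirected_tree_def by blast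
  qed
  with path adj uV \<open>u \<noteq> x\<close> show ?thesis by (auto simp: simple_path_def)
qed

lemma undirected_tree_ex_neighbor:
  assumes "undirected_tree G" "card (verts G) \<ge> 2" "v \<in> verts G"
  shows "neighbors G v \<noteq> {}"
proof -
  interpret graph G using assms by (simp add: undirected_tree_def)
  have "\<not> verts G \<subseteq> {v}"
    using assms(2) card_mono[of "{v}" "verts G"] by auto
  then obtain w where w: "w \<in> verts G" "w \<noteq> v" by blast
  \<comment> \<open>By symmetry, connectedness yields a directed walk from \<open>v\<close> to
    \<open>w\<close>; its first arc leads to a neighbor.\<close>
  have "strongly_connected G"
    using assms(1) sym_arcs symmetric_connected_imp_strongly_connected
    by (simp add: undirected_tree_def)
  with w assms(3) have "v \<rightarrow>\<^sup>*\<^bsub>G\<^esub> w" by (simp add: strongly_connected_def)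
  with w(2) obtain u where "v \<rightarrow>\<^bsub>G\<^esub> u"
    by (auto elim: converse_reachable_cases)
  then show ?thesis using adj_in_verts(2) by (fastforce simp: neighbors_def)
qed

lemma not_color_change_imp_leaf_outside:
  assumes tree: "undirected_tree G" and two: "card (verts G) \<ge> 2"
    and closed: "\<And>S'. \<not> color_change G S S'"
    and s: "s \<in> verts G" "s \<notin> S"
  shows "\<not> leaves G \<subseteq> insert s S"
proof
  assume leaves: "leaves G \<subseteq> insert s S"
  interpret graph G using tree by (simp add: undirected_tree_def)
  \<comment> \<open>The head is the white end where the path grows. Only the head must be white, so
    blue vertices may remain inside.\<close>
  define P where "P p \<longleftrightarrow> simple_path G p \<and> p \<noteq> [] \<and> last p = s \<and> hd p \<notin> S" for p
  have "P [s]" using s by (simp add: P_def simple_path_def)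
  moreover have "\<forall>p. P p \<longrightarrow> length p < Suc (card (verts G))"
    using card_mono[OF finite_verts] distinct_card
    unfolding P_def simple_path_def by (metis less_Suc_eq_le)
  ultimately obtain p where p: "P p" and longest: "\<And>p'. P p' \<Longrightarrow> length p' \<le> length p"
    using ex_has_greatest_nat[of P "[s]" length] by blast
  from p obtain x q where xq: "p = x # q" by (cases p) (auto simp: P_def)
  with p have path: "simple_path G (x # q)" and last: "last (x # q) = s" and x: "x \<notin> S" "x \<in> verts G"
    by (auto simp: P_def simple_path_def)
  have "\<exists>u. u \<in> neighbors G x \<and> (q \<noteq> [] \<longrightarrow> u \<noteq> hd q)"
  proof (cases "q = []")
    case True
    then show ?thesis using undirected_tree_ex_neighbor[OF tree two x(2)] by auto
  next
    case False
    \<comment> \<open>Since \<open>s\<close> is the last entry of a repetition-free list with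
      nonempty \<open>q\<close>, the head \<open>x\<close> is another vertex, and being white it
      cannot be a leaf.\<close>
    with last path have "x \<noteq> s" by (auto simp: simple_path_def)
    with x leaves have "card (neighbors G x) \<noteq> 1" by (auto simp: leaves_def)
    then have "neighbors G x \<noteq> {hd q}" by auto
    with undirected_tree_ex_neighbor[OF tree two x(2)] show ?thesis by auto
  qed
  then obtain u where u: "x \<rightarrow>\<^bsub>G\<^esub> u" "q \<noteq> [] \<Longrightarrow> u \<noteq> hd q" by (auto simp: neighbors_def)
  have ux: "u \<rightarrow>\<^bsub>G\<^esub> x" using undirected_tree_adj_sym[OF tree u(1)] .
  have path_u: "simple_path G (u # x # q)" using simple_path_extend[OF tree path ux u(2)] .
  show False
  proof (cases "u \<in> S")
    case False
    with path_u last have "P (u # x # q)" by (auto simp: P_def)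
    then show False using longest xq by fastforce
  next
    case True
    then have "neighbors G u - S \<noteq> {x}" using closed unfolding color_change_def by blast
    moreover have "x \<in> neighbors G u - S" using ux x by (simp add: neighbors_def)
    ultimately obtain w where w: "u \<rightarrow>\<^bsub>G\<^esub> w" "w \<notin> S" "w \<noteq> x" by (auto simp: neighbors_def)
    \<comment> \<open>Here the path being extended starts with \<open>u\<close>, so the vertex to
      avoid is its successor \<open>x\<close>.\<close>
    have "simple_path G (w # u # x # q)"
      using simple_path_extend[OF tree path_u undirected_tree_adj_sym[OF tree w(1)]] w(3) by simp
    with w last have "P (w # u # x # q)" by (auto simp: P_def)
    then show False using longest xq by fastforce
  qed
qed

text \<open>Each color change adds a new vertex, so a reachable set of largest cardinality admits no
  further change.\<close>

lemma color_change_closure_exists: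
  assumes fin: "finite (verts G)" and "F \<subseteq> verts G"
  obtains S where "(color_change G)\<^sup>*\<^sup>* F S" "F \<subseteq> S" "S \<subseteq> verts G" "\<And>S'. \<not> color_change G S S'"
proof -
  define P where "P S \<longleftrightarrow> (color_change G)\<^sup>*\<^sup>* F S \<and> F \<subseteq> S \<and> S \<subseteq> verts G" for S
  have "P F" using assms by (simp add: P_def)
  moreover have "\<forall>S. P S \<longrightarrow> card S < Suc (card (verts G))"
    using card_mono[OF fin] by (auto simp: P_def less_Suc_eq_le)
  ultimately obtain S where S: "P S" and largest: "\<And>S'. P S' \<Longrightarrow> card S' \<le> card S"
    using ex_has_greatest_nat[of P F card] by blast
  have "\<not> color_change G S S'" for S'
  proof
    assume change: "color_change G S S'"
    then obtain b w where w: "neighbors G b - S = {w}" "S' = insert w S"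
      by (auto simp: color_change_def)
    then have "w \<in> verts G" "w \<notin> S" by (auto simp: neighbors_def)
    with S change w have "P S'" by (auto simp: P_def intro: rtranclp.rtrancl_into_rtrancl)
    moreover have "finite S" using S fin finite_subset by (auto simp: P_def)
    ultimately show False using largest[of S'] w \<open>w \<notin> S\<close> by simp
  qed
  with S that show thesis by (auto simp: P_def)
qed

text \<open>The empty set is closed, having no blue vertex to force with, so for any vertex
  \<open>s\<close> there is a leaf other than \<open>s\<close>.\<close>

lemma leaves_nonempty:
  assumes "undirected_tree G" "card (verts G) \<ge> 2"
  shows "leaves G \<noteq> {}"
proof -
  obtain s where "s \<in> verts G" using assms(2) by fastforce
  then show ?thesis
    using not_color_change_imp_leaf_outside[OF assms, of "{}" s] by (auto simp: color_change_def)
qed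

lemma leaves_but_one_zero_forcing:
  assumes tree: "undirected_tree G" and two: "card (verts G) \<ge> 2"
    and F: "F \<subseteq> verts G" "leaves G \<subseteq> insert r F" "r \<in> verts G"
  shows "zero_forcing_set G F"
proof -
  interpret graph G using tree by (simp add: undirected_tree_def)
  obtain S where S: "(color_change G)\<^sup>*\<^sup>* F S" "F \<subseteq> S" "S \<subseteq> verts G"
    and closed: "\<And>S'. \<not> color_change G S S'"
    using color_change_closure_exists[OF finite_verts F(1)] by blast
  have "S = verts G"
  proof (rule ccontr)
    assume "S \<noteq> verts G"
    with S obtain v where v: "v \<in> verts G" "v \<notin> S" by blast
    \<comment> \<open>If \<open>r\<close> is blue then all leaves are blue, and any white vertex can
      serve as \<open>s\<close>; otherwise \<open>r\<close> itself is white and is the only leaf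
      that may be missing.\<close>
    define s where "s = (if r \<in> S then v else r)"
    have "s \<in> verts G" "s \<notin> S" "leaves G \<subseteq> insert s S" using v F S by (auto simp: s_def)
    then show False using not_color_change_imp_leaf_outside[OF tree two closed] by blast
  qed
  with S F show ?thesis by (simp add: zero_forcing_set_def)
qed

theorem theorem3p10:
  fixes T :: "('a, 'b) pre_digraph"
  assumes "undirected_tree T"
    and "card (verts T) \<ge> 2"
  shows "fault_tolerant_zero_forcing_set T (leaves T)
    \<and> fault_tolerant_zero_forcing_number T \<le> card (leaves T)"
proof -
  interpret graph T using assms by (simp add: undirected_tree_def)
  have sub: "leaves T \<subseteq> verts T" by (auto simp: leaves_def)
  then have fin: "finite (leaves T)" using finite_verts finite_subset by blast
  have pos: "card (leaves T) \<ge> 1"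
    using leaves_nonempty[OF assms] fin by (simp add: Suc_le_eq card_gt_0_iff)
  have "zero_forcing_set T F" if F: "F \<subseteq> leaves T" "card F = card (leaves T) - 1" for F
  proof -
    have "card (leaves T - F) = 1"
      using F pos fin by (simp add: card_Diff_subset finite_subset)
    then obtain r where "leaves T - F = {r}" by (auto simp: card_1_singleton_iff)
    then show ?thesis
      using leaves_but_one_zero_forcing[OF assms, of F r] F sub by blast
  qed
  then have "fault_tolerant_zero_forcing_set T (leaves T)"
    using sub pos by (simp add: fault_tolerant_zero_forcing_set_def)
  then show ?thesis
    unfolding fault_tolerant_zero_forcing_number_def by (auto intro: Least_le)
qed

end
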